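(* Let $X\in\mathbb{R}^{m\times n}_+$, $W\in\mathbb{R}^{m\times r}$, $H\in\mathbb{R}^{r\times n}_+$ with $X=WH$ satisfying the facet-based conditions (FBC) for some parameter $s$, where $d=\operatorname{rank}(X)$. Let $\bar x=\frac1n\sum_{j=1}^n X(:,j)$, $e$ the all-ones vector, and assume $X-\bar x e^\top$ has rank $d-1$ with compact SVD $X-\bar xe^\top=U\Sigma V^\top$, $U\in\mathbb{R}^{m\times(d-1)}$ with orthonormal columns. Let $\tilde X=U^\top(X-\bar xe^\top)\in\mathbb{R}^{(d-1)\times n}$ and $\tilde W=U^\top(W-\bar xe^\top)$ (so $0\in\operatorname{conv}(\tilde X)$, $\operatorname{rank}(\tilde X)=d-1$ and $\tilde X=\tilde WH$). Then the set of vertices of $\operatorname{conv}(\tilde X)^*$ contains all the vertices of $\operatorname{conv}(\tilde W)^*$.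
   Context: For a matrix $M$, $\operatorname{conv}(M)$ denotes the convex hull of its columns. For a set $\mathcal A$ containing the origin in its interior, its dual is $\mathcal A^*=\{y: x^\top y\le 1 \text{ for all } x\in\mathcal A\}$; in particular $\operatorname{conv}(\tilde X)^*=\{\theta:\tilde X^\top\theta\le e\}$. A facet of a polytope is a face of dimension one less than the dimension of the polytope. The unit simplex is $\Delta^r=\{x\in\mathbb{R}^r: x\ge 0,\ \sum_i x_i=1\}$. Facet-based conditions (FBC) with parameter $s$ for $X=WH$, where $d=\operatorname{rank}(X)$: (a) no column of $W$ lies in the convex hull of the other columns of $W$; (b) $H(:,j)\in\Delta^r$ for all $j$; (c) each facet of $\operatorname{conv}(W)$ contains at least $s\ge d$ distinct columns of $X$, and among them at least $d-1$ generate that facet (the convex hull of these $s$ columns has dimension $d-2$); (d) every facet of $\operatorname{conv}(X)$ which is not a facet of $\operatorname{conv}(W)$ contains strictly fewer than $s$ distinct columns of $X$. *)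

theory Defs
  imports "HOL-Analysis.Analysis"
begin

text \<open>Convex hull of the columns of a matrix.\<close>
definition conv_cols :: "real^'n^'m \<Rightarrow> (real^'m) set" where
  "conv_cols M = convex hull (columns M)"

text \<open>Dual (polar) set: A^* = {y. x.y <= 1 for all x in A}.\<close>
definition polar_dual :: "(real^'k) set \<Rightarrow> (real^'k) set" where
  "polar_dual A = {y. \<forall>x\<in>A. x \<bullet> y \<le> 1}"

text \<open>Unit simplex.\<close>
definition unit_simplex :: "(real^'r) set" where
  "unit_simplex = {x. (\<forall>i. 0 \<le> x $ i) \<and> (\<Sum>i\<in>UNIV. x $ i) = 1}"

text \<open>Facet-based conditions (FBC) with parameter s for X = W H, d = rank X.\<close>
definition FBC :: "real^'n^'m \<Rightarrow> real^'r^'m \<Rightarrow> real^'n^'r \<Rightarrow> nat \<Rightarrow> bool" where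
  "FBC X W H s \<longleftrightarrow>
     X = W ** H \<and>
     (\<forall>i. column i W \<notin> convex hull {column k W | k. k \<noteq> i}) \<and>
     (\<forall>j. column j H \<in> unit_simplex) \<and>
     s \<ge> rank X \<and>
     (\<forall>F. F facet_of conv_cols W \<longrightarrow>
          card (F \<inter> columns X) \<ge> s \<and>
          aff_dim (convex hull (F \<inter> columns X)) = int (rank X) - 2) \<and>
     (\<forall>G. G facet_of conv_cols X \<and> \<not> G facet_of conv_cols W \<longrightarrow>
          card (G \<inter> columns X) < s)"

text \<open>Mean column xbar = (1/n) sum_j X(:,j).\<close>
definition mean_col :: "real^'n^'m \<Rightarrow> real^'m" where
  "mean_col X = (1 / real CARD('n)) *\<^sub>R (\<Sum>j\<in>UNIV. column j X)"

text \<open>M - c e^T.\<close>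
definition sub_col :: "real^'n^'m \<Rightarrow> real^'m \<Rightarrow> real^'n^'m" where
  "sub_col M c = (\<chi> i j. M $ i $ j - c $ i)"

end

theory Submission
  imports Defs
begin

text \<open>
  Write T x = U^T (x - xbar), so that the columns of X' and W' are the images under T of
  the columns of X and W. A vertex v of conv(W')^* is determined by the columns of W'
  active at v (those w' with w' . v = 1): they span the whole (d-1)-space. Pulled back
  through T, v becomes the hyperplane a . x = 1 + a . xbar with a = U v; it supports conv(W),
  and the active columns of W have affine dimension d-2, so it cuts out a facet F of
  conv(W). By FBC (c), F contains columns of X of affine dimension d-2; their images are
  columns of X' active at v which again span the space. Since conv(X) is contained in
  conv(W), v lies in conv(X')^*, hence it is one of its vertices.

  T preserves affine dimension only on the affine hull of the columns of X, which the
  range of U covers after centring. FBC (d) shows that conv(W) has the same affine hull: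
  a facet of conv(W) meets conv(X) in a facet of conv(X) with at least s columns, which
  must therefore be a facet of conv(W) as well.
\<close>

lemma polar_dual_convex_hull:
  "polar_dual (convex hull S) = {y. \<forall>x\<in>S. x \<bullet> y \<le> 1}"
proof -
  have "convex hull S \<subseteq> {x. y \<bullet> x \<le> 1}" if "\<forall>x\<in>S. x \<bullet> y \<le> 1" for y
    using that by (intro hull_minimal convex_halfspace_le) (auto simp: inner_commute)
  then show ?thesis
    unfolding polar_dual_def using hull_subset[of S convex] by (fastforce simp: inner_commute)
qed

lemma polar_perturbation:
  fixes S :: "'a::euclidean_space set"
  assumes "finite S" and v: "\<forall>x\<in>S. x \<bullet> v \<le> 1"
    and z: "\<And>x. x \<in> S \<Longrightarrow> x \<bullet> v = 1 \<Longrightarrow> x \<bullet> z = 0"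
  obtains t where "t > 0" "\<forall>x\<in>S. x \<bullet> (v + t *\<^sub>R z) \<le> 1"
    "\<forall>x\<in>S. x \<bullet> (v - t *\<^sub>R z) \<le> 1"
proof -
  have "\<forall>\<^sub>F t in nhds 0. \<forall>x\<in>S. x \<bullet> v < 1 \<longrightarrow> x \<bullet> (v + t *\<^sub>R z) < 1 \<and> x \<bullet> (v - t *\<^sub>R z) < 1"
  proof (intro eventually_ball_finite[OF \<open>finite S\<close>] ballI)
    fix x assume "x \<in> S"
    have "((\<lambda>t. x \<bullet> (v + t *\<^sub>R z)) \<longlongrightarrow> x \<bullet> v) (nhds 0)"
         "((\<lambda>t. x \<bullet> (v - t *\<^sub>R z)) \<longlongrightarrow> x \<bullet> v) (nhds 0)"
      by (auto intro!: tendsto_eq_intros filterlim_ident)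
    then show "\<forall>\<^sub>F t in nhds 0. x \<bullet> v < 1 \<longrightarrow> x \<bullet> (v + t *\<^sub>R z) < 1 \<and> x \<bullet> (v - t *\<^sub>R z) < 1"
      by (cases "x \<bullet> v < 1") (auto intro: eventually_conj order_tendstoD)
  qed
  then obtain e where "e > 0" and e: "\<And>t. \<bar>t\<bar> < e \<Longrightarrow>
      \<forall>x\<in>S. x \<bullet> v < 1 \<longrightarrow> x \<bullet> (v + t *\<^sub>R z) < 1 \<and> x \<bullet> (v - t *\<^sub>R z) < 1"
    by (auto simp: eventually_nhds_metric dist_real_def)
  have "x \<bullet> (v + (e / 2) *\<^sub>R z) \<le> 1 \<and> x \<bullet> (v - (e / 2) *\<^sub>R z) \<le> 1" if "x \<in> S" for x
  proof (cases "x \<bullet> v = 1")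
    case True
    then show ?thesis using z[of x] that by (simp add: inner_add_right inner_diff_right)
  next
    case False
    then show ?thesis using v e[of "e / 2"] \<open>e > 0\<close> that by fastforce
  qed
  with \<open>e > 0\<close> show ?thesis using that[of "e / 2"] by auto
qed

lemma extreme_point_of_polar_imp_span_active:
  fixes S :: "'a::euclidean_space set"
  assumes "finite S" and ext: "v extreme_point_of {y. \<forall>x\<in>S. x \<bullet> y \<le> 1}"
  shows "span {x\<in>S. x \<bullet> v = 1} = UNIV"
proof (rule ccontr)
  assume "span {x\<in>S. x \<bullet> v = 1} \<noteq> UNIV"
  then obtain z where "z \<noteq> 0" and z0: "\<forall>x\<in>span {x\<in>S. x \<bullet> v = 1}. z \<bullet> x = 0"
    using span_not_UNIV_orthogonal by blast
  have z: "x \<bullet> z = 0" if "x \<in> S" "x \<bullet> v = 1" for x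
    using z0 span_base[of x "{x\<in>S. x \<bullet> v = 1}"] that by (simp add: inner_commute)
  have "\<forall>x\<in>S. x \<bullet> v \<le> 1" using ext by (simp add: extreme_point_of_def)
  then obtain t where "t > 0" and in_P: "\<forall>x\<in>S. x \<bullet> (v + t *\<^sub>R z) \<le> 1"
    "\<forall>x\<in>S. x \<bullet> (v - t *\<^sub>R z) \<le> 1"
    using polar_perturbation[OF \<open>finite S\<close> _ z] by blast
  have "v - t *\<^sub>R z \<noteq> v + t *\<^sub>R z"
    using \<open>t > 0\<close> \<open>z \<noteq> 0\<close> by (simp add: algebra_simps flip: scaleR_2)
  moreover have "midpoint (v - t *\<^sub>R z) (v + t *\<^sub>R z) = v" by (simp add: midpoint_def)
  ultimately have "v \<in> open_segment (v - t *\<^sub>R z) (v + t *\<^sub>R z)"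
    by (metis midpoint_in_open_segment)
  with in_P show False using ext by (auto simp: extreme_point_of_def)
qed

lemma extreme_point_of_polarI:
  fixes S :: "'a::euclidean_space set"
  assumes v: "\<forall>x\<in>S. x \<bullet> v \<le> 1" and span: "span {x\<in>S. x \<bullet> v = 1} = UNIV"
  shows "v extreme_point_of {y. \<forall>x\<in>S. x \<bullet> y \<le> 1}"
proof -
  let ?P = "{y. \<forall>x\<in>S. x \<bullet> y \<le> 1}" and ?A = "{x\<in>S. x \<bullet> v = 1}"
  have "?A \<noteq> {}"
    using span nonzero_Basis by (metis UNIV_I SOME_Basis singletonD span_empty)
  have "w = v" if "\<forall>x\<in>?A. x \<bullet> w = 1" for w
  proof -
    have "orthogonal (w - v) x" if "x \<in> ?A" for x
      using that \<open>\<forall>x\<in>?A. x \<bullet> w = 1\<close> by (simp add: orthogonal_def inner_diff_right inner_commute[of _ x])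
    then have "orthogonal (w - v) (w - v)"
      using orthogonal_to_span span by blast
    then show "w = v" by (simp add: orthogonal_def)
  qed
  then have v_eq: "{v} = \<Inter> ((\<lambda>x. ?P \<inter> {y. x \<bullet> y = 1}) ` ?A)"
    using v \<open>?A \<noteq> {}\<close> by auto
  have "?P = (\<Inter>x\<in>S. {y. x \<bullet> y \<le> 1})" by auto
  then have "convex ?P" by (simp add: convex_INT convex_halfspace_le)
  then have "?P \<inter> {y. x \<bullet> y = 1} face_of ?P" if "x \<in> S" for x
    using that by (intro face_of_Int_supporting_hyperplane_le) auto
  then have "\<Inter> ((\<lambda>x. ?P \<inter> {y. x \<bullet> y = 1}) ` ?A) face_of ?P"
    using \<open>?A \<noteq> {}\<close> by (intro face_of_Inter) auto
  then show ?thesis unfolding face_of_singleton[symmetric] v_eq .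
qed

lemma span_eq_UNIV_iff_aff_dim:
  fixes S :: "'a::euclidean_space set"
  assumes "\<And>y. y \<in> S \<Longrightarrow> y \<bullet> v = 1"
  shows "span S = UNIV \<longleftrightarrow> aff_dim S = int DIM('a) - 1"
proof -
  have "affine hull S \<subseteq> {y. v \<bullet> y = 1}"
    using assms affine_hyperplane[of v 1] by (intro hull_minimal) (auto simp: inner_commute)
  then have "0 \<notin> affine hull S" by auto
  then have "aff_dim (insert 0 S) = aff_dim S + 1" by (simp add: aff_dim_insert)
  moreover have "aff_dim (insert 0 S) = int (dim S)"
    by (metis aff_dim_zero dim_span hull_inc insertI1 span_insert_0)
  ultimately have "aff_dim S = int (dim S) - 1" by simp
  then show ?thesis using dim_eq_full[of S] by auto
qed

lemma facet_of_if_aff_dim_ge: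
  fixes S :: "'a::euclidean_space set"
  assumes "convex S" "F face_of S" "F \<noteq> {}" "F \<noteq> S" "aff_dim S - 1 \<le> aff_dim F"
  shows "F facet_of S"
  using face_of_aff_dim_lt[OF assms(1,2,4)] assms by (simp add: facet_of_def)

lemma facet_of_supporting_hyperplane:
  fixes S :: "'a::euclidean_space set"
  assumes "convex S" and le: "\<And>x. x \<in> S \<Longrightarrow> a \<bullet> x \<le> b"
    and Q: "Q \<subseteq> S \<inter> {x. a \<bullet> x = b}" "Q \<noteq> {}" "aff_dim S - 1 \<le> aff_dim Q"
    and c: "c \<in> S" "a \<bullet> c \<noteq> b"
  shows "S \<inter> {x. a \<bullet> x = b} facet_of S"
proof (rule facet_of_if_aff_dim_ge)
  show "S \<inter> {x. a \<bullet> x = b} face_of S"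
    using \<open>convex S\<close> le by (rule face_of_Int_supporting_hyperplane_le)
  show "aff_dim S - 1 \<le> aff_dim (S \<inter> {x. a \<bullet> x = b})"
    using Q aff_dim_subset[OF Q(1)] by linarith
qed (use assms in auto)

lemma polytope_obtain_facet:
  fixes S :: "'a::euclidean_space set"
  assumes "polytope S" "aff_dim S > 0"
  obtains F where "F facet_of S"
proof -
  have "S \<noteq> {}" using assms(2) by auto
  then obtain x where "x extreme_point_of S"
    using extreme_point_exists_convex polytope_imp_compact polytope_imp_convex assms(1) by metis
  moreover have "{x} \<noteq> S" using assms(2) by auto
  ultimately show ?thesis
    using face_of_polyhedron_subset_facet polytope_imp_polyhedron assms(1) that
    by (metis face_of_singleton insert_not_empty)
qed

lemma column_matrix_matrix_mult: "column j (A ** B) = A *v column j (B::real^'n^'k)"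
  by (simp add: vec_eq_iff column_def matrix_matrix_mult_def matrix_vector_mult_def)

lemma column_sub_col: "column j (sub_col M c) = column j M - c"
  by (simp add: vec_eq_iff column_def sub_col_def)

lemma columns_eq_image: "columns M = (\<lambda>j. column j M) ` UNIV"
  by (auto simp: columns_def)

lemma conv_cols_matrix_mult_subset:
  assumes "\<And>j. column j H \<in> unit_simplex"
  shows "conv_cols (W ** H) \<subseteq> conv_cols W"
  unfolding conv_cols_def
proof (intro hull_minimal subsetI convex_convex_hull)
  fix x assume "x \<in> columns (W ** H)"
  then obtain j where "x = column j (W ** H)" by (auto simp: columns_def)
  also have "\<dots> = (\<Sum>i\<in>UNIV. column j H $ i *\<^sub>R column i W)"
    by (simp add: column_matrix_matrix_mult matrix_mult_sum scalar_mult_eq_scaleR)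
  finally show "x \<in> convex hull columns W"
    using assms[of j] by (auto simp: unit_simplex_def columns_def intro!: convex_sum intro: hull_inc)
qed

lemma mean_col_in_conv_cols:
  fixes X :: "real^'n^'m"
  shows "mean_col X \<in> conv_cols X"
proof -
  have "mean_col X = (\<Sum>j\<in>UNIV. (1 / real CARD('n)) *\<^sub>R column j X)"
    by (simp add: mean_col_def scaleR_sum_right)
  also have "\<dots> \<in> conv_cols X" unfolding conv_cols_def
    by (rule convex_sum) (auto simp: columns_def intro: hull_inc)
  finally show ?thesis .
qed

lemma aff_dim_columns_eq_rank_sub_col:
  fixes X :: "real^'n^'m"
  assumes "c \<in> affine hull (columns X)"
  shows "aff_dim (columns X) = int (rank (sub_col X c))"
proof -
  have "(+) (- c) ` columns X = columns (sub_col X c)"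
    by (simp add: columns_eq_image column_sub_col image_image)
  then show ?thesis
    using aff_dim_eq_dim[OF assms] by (simp add: column_rank_def)
qed

definition centered_coords :: "real^'k^'m \<Rightarrow> real^'m \<Rightarrow> real^'m \<Rightarrow> real^'k" where
  "centered_coords U c p = transpose U *v (p - c)"

lemma inner_centered_coords: "centered_coords U c p \<bullet> v = (U *v v) \<bullet> (p - c)"
proof -
  have "centered_coords U c p \<bullet> v = ((p - c) v* U) \<bullet> v"
    by (simp add: centered_coords_def)
  also have "\<dots> = (p - c) \<bullet> (U *v v)"
    by (rule dot_lmul_matrix)
  finally show ?thesis by (simp only: inner_commute)
qed

lemma columns_centered_coords:
  "columns (transpose U ** sub_col M c) = centered_coords U c ` columns M"
  by (simp add: columns_eq_image image_image column_matrix_matrix_mult column_sub_col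
      centered_coords_def del: transpose_matrix_vector)

lemma centered_coords_left_inverse:
  fixes X :: "real^'n^'m" and U :: "real^'k^'m"
  assumes UU: "transpose U ** U = mat 1" and range: "sub_col X c = U ** B"
    and p: "p \<in> affine hull (columns X)"
  shows "U *v centered_coords U c p = p - c"
proof -
  have "affine ((+) c ` range ((*v) U))"
    by (intro affine_translation[THEN iffD1] subspace_imp_affine subspace_UNIV
        linear_subspace_image matrix_vector_mul_linear)
  moreover have "columns X \<subseteq> (+) c ` range ((*v) U)"
  proof
    fix x assume "x \<in> columns X"
    then obtain j where "x = column j X" by (auto simp: columns_def)
    then have "x = c + U *v column j B"
      using range column_sub_col[of j X c] by (simp add: column_matrix_matrix_mult)
    then show "x \<in> (+) c ` range ((*v) U)" by blast
  qed
  ultimately have "p \<in> (+) c ` range ((*v) U)" using p hull_minimal by blast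
  then obtain w where "p - c = U *v w" by auto
  then show ?thesis
    by (simp add: centered_coords_def matrix_vector_mul_assoc UU del: transpose_matrix_vector)
qed

lemma aff_dim_centered_coords_image:
  fixes U :: "real^'k^'m"
  assumes "transpose U ** U = mat 1" and "\<And>p. p \<in> S \<Longrightarrow> U *v centered_coords U c p = p - c"
  shows "aff_dim (centered_coords U c ` S) = aff_dim S"
proof -
  have "inj ((*v) U)"
    by (metis assms(1) inj_on_inverseI matrix_vector_mul_assoc matrix_vector_mul_lid)
  have "(+) c ` (*v) U ` centered_coords U c ` S = S"
    using assms(2) by (force simp: image_image)
  then show ?thesis
    by (metis \<open>inj ((*v) U)\<close> aff_dim_injective_linear_image aff_dim_translation_eq
        matrix_vector_mul_linear)
qed

lemma FBC_conv_cols_subset: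
  assumes "FBC X W H s"
  shows "conv_cols X \<subseteq> conv_cols W"
proof -
  have "X = W ** H" "\<And>j. column j H \<in> unit_simplex" using assms by (simp_all add: FBC_def)
  then show ?thesis by (simp add: conv_cols_matrix_mult_subset)
qed

lemma FBC_aff_dim_conv_cols_eq:
  assumes fbc: "FBC X W H s"
    and dimX: "aff_dim (conv_cols X) = int (rank X) - 1" and pos: "0 < aff_dim (conv_cols X)"
  shows "aff_dim (conv_cols W) = aff_dim (conv_cols X)"
proof -
  have XW: "conv_cols X \<subseteq> conv_cols W" using fbc by (rule FBC_conv_cols_subset)
  have "polytope (conv_cols W)" by (simp add: conv_cols_def columns_eq_image polytope_convex_hull)
  moreover have "0 < aff_dim (conv_cols W)" using aff_dim_subset[OF XW] pos by linarith
  ultimately obtain F where F: "F facet_of conv_cols W" by (rule polytope_obtain_facet)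
  define Z where "Z = F \<inter> columns X"
  have "s \<le> card Z" and dimZ: "aff_dim Z = aff_dim (conv_cols X) - 1"
    using fbc F dimX by (auto simp: FBC_def Z_def aff_dim_convex_hull)
  define G where "G = F \<inter> conv_cols X"
  have cols_X: "columns X \<subseteq> conv_cols X" by (simp add: conv_cols_def hull_subset)
  then have ZG: "Z \<subseteq> G" "G \<inter> columns X = Z" by (auto simp: Z_def G_def)
  have "G facet_of conv_cols X"
  proof (rule facet_of_if_aff_dim_ge)
    show "G face_of conv_cols X"
      using face_of_Int_Int[OF facet_of_imp_face_of[OF F] face_of_refl[of "conv_cols X"]] XW
      by (simp add: G_def conv_cols_def Int_absorb1)
    show "G \<noteq> {}" using ZG pos dimZ by auto
    show "G \<noteq> conv_cols X"
    proof
      assume "G = conv_cols X"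
      then have "Z = columns X" using ZG cols_X by auto
      then show False using dimZ by (simp add: conv_cols_def aff_dim_convex_hull)
    qed
    show "aff_dim (conv_cols X) - 1 \<le> aff_dim G" using aff_dim_subset[OF ZG(1)] dimZ by simp
  qed (simp add: conv_cols_def)
  then have "G facet_of conv_cols W"
    using fbc \<open>s \<le> card Z\<close> ZG(2) by (auto simp: FBC_def)
  then show ?thesis
    using \<open>G facet_of conv_cols X\<close> by (simp add: facet_of_def)
qed

lemma extreme_point_polar_centered_coords_transfer:
  fixes U :: "real^'k^'m" and P Y :: "(real^'m) set"
  assumes "finite P" and Y: "Y \<subseteq> convex hull P" and c: "c \<in> convex hull P"
    and UU: "transpose U ** U = mat 1"
    and inv: "\<And>p. p \<in> affine hull P \<Longrightarrow> U *v centered_coords U c p = p - c"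
    and dimP: "aff_dim (convex hull P) = int CARD('k)"
    and facets: "\<And>F. F facet_of convex hull P \<Longrightarrow> aff_dim (F \<inter> Y) = int CARD('k) - 1"
    and v: "v extreme_point_of polar_dual (convex hull (centered_coords U c ` P))"
  shows "v extreme_point_of polar_dual (convex hull (centered_coords U c ` Y))"
proof -
  let ?T = "centered_coords U c"
  define a where "a = U *v v"
  have Tv: "?T p \<bullet> v = a \<bullet> p - a \<bullet> c" for p
    by (simp add: a_def inner_centered_coords inner_diff_right)
  have aff_dim_T: "aff_dim (?T ` S) = aff_dim S" if "S \<subseteq> affine hull P" for S
    using that by (intro aff_dim_centered_coords_image UU inv) auto
  have ext: "v extreme_point_of {y. \<forall>x\<in>?T ` P. x \<bullet> y \<le> 1}"
    using v by (simp only: polar_dual_convex_hull)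
  then have v_le: "\<forall>x\<in>?T ` P. x \<bullet> v \<le> 1" unfolding extreme_point_of_def by blast
  have span_active: "span {x \<in> ?T ` P. x \<bullet> v = 1} = UNIV"
    using extreme_point_of_polar_imp_span_active[OF _ ext] \<open>finite P\<close> by simp
  from v_le have "P \<subseteq> {p. a \<bullet> p \<le> 1 + a \<bullet> c}" by (auto simp: Tv)
  then have le: "convex hull P \<subseteq> {p. a \<bullet> p \<le> 1 + a \<bullet> c}"
    by (intro hull_minimal convex_halfspace_le)
  define Q where "Q = {p\<in>P. a \<bullet> p = 1 + a \<bullet> c}"
  have "?T ` Q = {x \<in> ?T ` P. x \<bullet> v = 1}" by (auto simp: Q_def Tv)
  moreover have "Q \<subseteq> affine hull P" by (auto simp: Q_def intro: hull_inc)
  ultimately have dimQ: "aff_dim Q = int CARD('k) - 1"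
    using span_active span_eq_UNIV_iff_aff_dim[of "?T ` Q" v] aff_dim_T[of Q] by auto
  define F where "F = convex hull P \<inter> {p. a \<bullet> p = 1 + a \<bullet> c}"
  have "F facet_of convex hull P"
    unfolding F_def
  proof (rule facet_of_supporting_hyperplane[where Q = Q and c = c])
    show "Q \<subseteq> convex hull P \<inter> {p. a \<bullet> p = 1 + a \<bullet> c}" by (auto simp: Q_def hull_inc)
    show "Q \<noteq> {}" using dimQ by auto
    show "\<And>x. x \<in> convex hull P \<Longrightarrow> a \<bullet> x \<le> 1 + a \<bullet> c" using le by blast
    show "aff_dim (convex hull P) - 1 \<le> aff_dim Q" using dimP dimQ by simp
  qed (simp_all add: c)
  then have "aff_dim (F \<inter> Y) = int CARD('k) - 1" by (rule facets)
  moreover have "F \<inter> Y \<subseteq> affine hull P" using Y convex_hull_subset_affine_hull by blast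
  ultimately have dim_TFY: "aff_dim (?T ` (F \<inter> Y)) = int CARD('k) - 1"
    using aff_dim_T by simp
  have "y \<bullet> v = 1" if "y \<in> ?T ` (F \<inter> Y)" for y
    using that by (auto simp: F_def Tv)
  then have "span (?T ` (F \<inter> Y)) = UNIV"
    using span_eq_UNIV_iff_aff_dim[of "?T ` (F \<inter> Y)" v] dim_TFY by simp
  moreover have "span (?T ` (F \<inter> Y)) \<subseteq> span {x \<in> ?T ` Y. x \<bullet> v = 1}"
    by (intro span_mono) (auto simp: F_def Tv)
  ultimately have "span {x \<in> ?T ` Y. x \<bullet> v = 1} = UNIV" by blast
  moreover have "\<forall>x\<in>?T ` Y. x \<bullet> v \<le> 1" using Y le by (auto simp: Tv)
  ultimately have "v extreme_point_of {y. \<forall>x\<in>?T ` Y. x \<bullet> y \<le> 1}"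
    by (intro extreme_point_of_polarI)
  then show ?thesis by (simp only: polar_dual_convex_hull)
qed

lemma FBC_extreme_point_polar_transfer:
  fixes X :: "real^'n^'m" and W :: "real^'r^'m" and U :: "real^'k^'m"
  assumes fbc: "FBC X W H s" and c: "c \<in> conv_cols X"
    and rank_centered: "rank (sub_col X c) = CARD('k)" and rank_X: "rank X = CARD('k) + 1"
    and UU: "transpose U ** U = mat 1" and range: "sub_col X c = U ** B"
    and v: "v extreme_point_of polar_dual (conv_cols (transpose U ** sub_col W c))"
  shows "v extreme_point_of polar_dual (conv_cols (transpose U ** sub_col X c))"
proof -
  have XW: "conv_cols X \<subseteq> conv_cols W" using fbc by (rule FBC_conv_cols_subset)
  have dimX: "aff_dim (conv_cols X) = int CARD('k)"
    using aff_dim_columns_eq_rank_sub_col[of c X] c convex_hull_subset_affine_hull rank_centered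
    by (auto simp: conv_cols_def aff_dim_convex_hull)
  then have dimW: "aff_dim (conv_cols W) = int CARD('k)"
    using FBC_aff_dim_conv_cols_eq[OF fbc] rank_X by simp
  then have "affine hull columns W = affine hull columns X"
    using aff_dim_eq_full_gen[OF XW] dimX by (simp add: conv_cols_def)
  then have inv: "U *v centered_coords U c p = p - c" if "p \<in> affine hull columns W" for p
    using centered_coords_left_inverse[OF UU range] that by simp
  have facets: "aff_dim (F \<inter> columns X) = int CARD('k) - 1" if "F facet_of convex hull columns W" for F
    using fbc that rank_X by (auto simp: FBC_def conv_cols_def aff_dim_convex_hull)
  have "columns X \<subseteq> convex hull columns W"
    using XW hull_subset[of "columns X" convex] unfolding conv_cols_def by blast
  moreover have "finite (columns W)" by (simp add: columns_eq_image)
  ultimately show ?thesis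
    using extreme_point_polar_centered_coords_transfer[OF _ _ _ UU inv _ facets] v c XW dimW
    unfolding conv_cols_def columns_centered_coords by blast
qed

theorem lemma2:
  fixes X :: "real^'n^'m" and W :: "real^'r^'m" and H :: "real^'n^'r"
    and s d :: nat
    and U :: "real^'k^'m" and Sigma :: "real^'k^'k" and V :: "real^'k^'n"
  assumes X_nonneg: "\<forall>i j. 0 \<le> X $ i $ j"
    and H_nonneg: "\<forall>i j. 0 \<le> H $ i $ j"
    and fbc: "FBC X W H s"
    and d_def: "d = rank X"
    and rank_centered: "rank (sub_col X (mean_col X)) = d - 1"
    and k_dim: "CARD('k) = d - 1"
    and svd: "sub_col X (mean_col X) = U ** Sigma ** transpose V"
    and U_orth: "transpose U ** U = mat 1"
    and V_orth: "transpose V ** V = mat 1"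
    and Sigma_diag: "\<forall>i j. i \<noteq> j \<longrightarrow> Sigma $ i $ j = 0"
    and Sigma_pos: "\<forall>i. 0 < Sigma $ i $ i"
  shows "{v. v extreme_point_of
              polar_dual (conv_cols (transpose U ** sub_col W (mean_col X)))}
         \<subseteq> {v. v extreme_point_of
              polar_dual (conv_cols (transpose U ** sub_col X (mean_col X)))}"
proof
  fix v
  assume "v \<in> {v. v extreme_point_of
              polar_dual (conv_cols (transpose U ** sub_col W (mean_col X)))}"
  moreover have "rank X = CARD('k) + 1"
    using k_dim d_def zero_less_card_finite[where 'a = 'k] by linarith
  moreover have "rank (sub_col X (mean_col X)) = CARD('k)" using rank_centered k_dim by simp
  moreover have "sub_col X (mean_col X) = U ** (Sigma ** transpose V)"
    using svd by (simp add: matrix_mul_assoc)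
  ultimately show "v \<in> {v. v extreme_point_of
              polar_dual (conv_cols (transpose U ** sub_col X (mean_col X)))}"
    using FBC_extreme_point_polar_transfer[OF fbc mean_col_in_conv_cols _ _ U_orth] by blast
qed

end
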